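(* Define sequences by $p_{-1}=-1$, $p_0=1$, $p_k=8p_{k-1}+p_{k-2}$ for $k\ge 1$, and $q_{-1}=4$, $q_0=0$, $q_k=8q_{k-1}+q_{k-2}$ for $k\ge 1$. For integers $k\ge 1$ and $n\ge 0$ put $a=p_k n+\frac{p_k+3}{2}$. Then $$\sqrt{a^2+(2q_k n+q_k+2)}=\left[a;\ \overline{\underbrace{1,1,3,\dots,1,1,3}_{(1,1,3)\text{ repeated }k\text{ times}},\ a,\ \underbrace{3,1,1,\dots,3,1,1}_{(3,1,1)\text{ repeated }k\text{ times}},\ 2a}\right].$$
   Context: $[a_0;\overline{a_1,\dots,a_\ell}]$ denotes the value of the infinite simple continued fraction $a_0+\cfrac{1}{a_1+\cfrac{1}{a_2+\dotsb}}$ with first partial quotient $a_0$, after which the block $a_1,\dots,a_\ell$ of positive integers is repeated indefinitely. *)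

theory Defs
  imports Complex_Main
begin

text \<open>\<^term>\<open>cf_convergent c n\<close> is the finite continued fraction \<open>[c 0; c 1, \<dots>, c n]\<close>.\<close>

fun cf_convergent :: "(nat \<Rightarrow> int) \<Rightarrow> nat \<Rightarrow> real" where
  "cf_convergent c 0 = real_of_int (c 0)"
| "cf_convergent c (Suc n) = real_of_int (c 0) + 1 / cf_convergent (\<lambda>i. c (Suc i)) n"

text \<open>Being the value of a simple continued fraction is a relation, so that convergence
  is asserted; no value is assigned to a divergent expansion.\<close>

definition has_cf_expansion :: "real \<Rightarrow> (nat \<Rightarrow> int) \<Rightarrow> bool" where
  "has_cf_expansion x c \<longleftrightarrow> (\<forall>i\<ge>1. c i > 0) \<and> cf_convergent c \<longlonglongrightarrow> x"

text \<open>\<open>periodic_cf a\<^sub>0 [a\<^sub>1, \<dots>, a\<^sub>l]\<close> lists the partial quotients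
  \<open>a\<^sub>0, a\<^sub>1, \<dots>, a\<^sub>l, a\<^sub>1, \<dots>, a\<^sub>l, \<dots>\<close>; it is meant for a nonempty block.\<close>

definition periodic_cf :: "int \<Rightarrow> int list \<Rightarrow> nat \<Rightarrow> int" where
  "periodic_cf a0 block i = (case i of 0 \<Rightarrow> a0 | Suc j \<Rightarrow> block ! (j mod length block))"

text \<open>Parity of the sequence \<open>p\<close> in the theorem: the integer division
  \<open>(p k + 3) div 2\<close> used there is exact.\<close>

lemma even_seq_plus_3:
  fixes p :: "int \<Rightarrow> int" and k :: nat
  assumes p_minus_1: "p (-1) = -1" and p_0: "p 0 = 1"
    and p_rec: "\<And>j. j \<ge> 1 \<Longrightarrow> p j = 8 * p (j - 1) + p (j - 2)"
  shows "even (p (int k) + 3)"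
proof -
  have "odd (p (int k)) \<and> odd (p (int k - 1))"
  proof (induction k)
    case 0
    show ?case using p_minus_1 p_0 by simp
  next
    case (Suc k)
    then show ?case using p_rec[of "int (Suc k)"] by simp
  qed
  then show ?thesis by simp
qed

end

theory Submission
  imports Defs
begin

text \<open>
  Write \<open>x\<close> for the square root, \<open>m = x\<^sup>2 - a\<^sup>2\<close> and \<open>s = x + a\<close>, so that
  \<open>x = a + 1 / y\<close> with \<open>y = s / m\<close>. The expansion of \<open>x\<close> has period \<open>B\<close> after \<open>a\<close> as soon as \<open>y\<close> is a fixed
  point of the Moebius map \<open>t \<mapsto> [B, t]\<close>: then all complete quotients are known explicitly,
  and a continued fraction with positive partial quotients converges to any number whose
  complete quotients are at least 1 (\<open>convergents_tendsto\<close>, \<open>periodic_expansion\<close>).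

  The maps \<open>t \<mapsto> [1, 1, 3, t]\<close> and \<open>t \<mapsto> [3, 1, 1, t]\<close> have the matrices
  \<open>A = ((7, 2), (4, 1))\<close> and its transpose. Since \<open>A\<close> has trace 8 and determinant -1, its
  powers satisfy the recurrence \<open>A\<^sup>k = 8 A\<^sup>k\<^sup>-\<^sup>1 + A\<^sup>k\<^sup>-\<^sup>2\<close>, and the first column of \<open>A\<^sup>k\<close>
  is \<open>(p\<^sub>k, q\<^sub>k)\<close>; in full
  \<open>A\<^sup>k = ((p\<^sub>k, v\<^sub>k), (2 v\<^sub>k, p\<^sub>k - 3 v\<^sub>k))\<close> with \<open>v\<^sub>k = q\<^sub>k / 2\<close>.

  The last partial quotient \<open>2 a\<close> followed by \<open>y\<close> gives \<open>2 a + m / s = s\<close>. So \<open>y\<close> is a fixed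
  point exactly if the map with the symmetric matrix
  \<open>A\<^sup>k ((a, 1), (1, 0)) (A\<^sup>k)\<^sup>T = ((P, Q), (Q, R))\<close> sends \<open>s\<close> to \<open>s / m\<close>, that is, if
  \<open>Q s\<^sup>2 + (R - m P) s - m Q = 0\<close>. As \<open>s\<^sup>2 = 2 a s + m\<close>, this reduces to \<open>2 a Q + R = m P\<close>,
  an identity in \<open>p\<^sub>k\<close>, \<open>v\<^sub>k\<close> and \<open>n\<close> once the definitions of \<open>a\<close> and \<open>m\<close> are inserted.
\<close>

section \<open>Convergence from complete quotients\<close>

lemma cf_convergent_ge_1:
  assumes "\<And>i. c i \<ge> 1"
  shows "cf_convergent c n \<ge> 1"
  using assms
proof (induction n arbitrary: c)
  case 0
  then show ?case by simp
next
  case (Suc n)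
  have "cf_convergent (\<lambda>i. c (Suc i)) n \<ge> 1"
    by (rule Suc.IH) (rule Suc.prems)
  moreover have "real_of_int (c 0) \<ge> 1"
    using Suc.prems[of 0] by simp
  ultimately show ?case by (simp add: add_increasing2)
qed

text \<open>One step \<open>t \<mapsto> b + 1 / t\<close> need not contract near \<open>t = 1\<close>. Two steps do: they divide a
  difference by the products \<open>x t\<close> and \<open>x' t'\<close> of consecutive quotients, where
  \<open>x t = b t + 1 \<ge> 2\<close> for \<open>x = b + 1 / t\<close>, and likewise for \<open>x' t'\<close>.\<close>

lemma two_step_contraction:
  fixes b u v :: real
  assumes "b \<ge> 1" "u \<ge> 1" "v \<ge> 1"
  shows "\<bar>1 / (b + 1 / u) - 1 / (b + 1 / v)\<bar> \<le> \<bar>u - v\<bar> / 4"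
proof -
  have "b * u \<ge> 1" "b * v \<ge> 1"
    using assms mult_mono[of 1 b 1 u] mult_mono[of 1 b 1 v] by auto
  then have den: "(b * u + 1) * (b * v + 1) \<ge> 4"
    using mult_mono[of 2 "b * u + 1" 2 "b * v + 1"] by simp
  have "1 / (b + 1 / u) - 1 / (b + 1 / v) = u / (b * u + 1) - v / (b * v + 1)"
    using assms by (simp add: field_simps)
  also have "\<dots> = (u - v) / ((b * u + 1) * (b * v + 1))"
    using \<open>b * u \<ge> 1\<close> \<open>b * v \<ge> 1\<close> by (simp add: divide_simps) (simp add: algebra_simps)
  finally have "\<bar>1 / (b + 1 / u) - 1 / (b + 1 / v)\<bar> = \<bar>u - v\<bar> / ((b * u + 1) * (b * v + 1))"
    using den by (simp add: abs_divide)
  also have "\<dots> \<le> \<bar>u - v\<bar> / 4"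
    using den by (intro divide_left_mono) auto
  finally show ?thesis .
qed

text \<open>Induction in steps of two. The errors for \<open>n = 0\<close> and \<open>n = 1\<close> are at most 1, and the
  factor 2 makes the bound hold for both.\<close>

lemma convergents_error_bound:
  fixes X :: "nat \<Rightarrow> real"
  assumes "\<And>i. i \<ge> 1 \<Longrightarrow> c i \<ge> 1" and "\<And>i. i \<ge> 1 \<Longrightarrow> X i \<ge> 1"
    and "\<And>i. X i = real_of_int (c i) + 1 / X (Suc i)"
  shows "\<bar>cf_convergent c n - X 0\<bar> \<le> 2 * (1 / 2) ^ n"
  using assms
proof (induction n arbitrary: c X rule: induct_nat_012)
  case 0
  have "X 1 \<ge> 1" "X 0 = real_of_int (c 0) + 1 / X 1"
    using "0.prems"(2)[of 1] "0.prems"(3)[of 0] by auto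
  then have "\<bar>cf_convergent c 0 - X 0\<bar> \<le> 1"
    by simp
  then show ?case by simp
next
  case 1
  have "X 1 \<ge> 1" "real_of_int (c 1) \<ge> 1"
    using "1.prems"(1,2)[of 1] by auto
  then have "0 \<le> 1 / X 1" "1 / X 1 \<le> 1"
    "0 \<le> 1 / real_of_int (c 1)" "1 / real_of_int (c 1) \<le> 1"
    by auto
  moreover have "cf_convergent c (Suc 0) - X 0 = 1 / real_of_int (c 1) - 1 / X 1"
    using "1.prems"(3)[of 0] by simp
  ultimately have "\<bar>cf_convergent c (Suc 0) - X 0\<bar> \<le> 1"
    by linarith
  then show ?case by simp
next
  case (ge2 n)
  let ?d = "\<lambda>i. c (Suc (Suc i))" and ?Y = "\<lambda>i. X (Suc (Suc i))"
  have "\<bar>cf_convergent c (Suc (Suc n)) - X 0\<bar>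
      = \<bar>1 / (real_of_int (c 1) + 1 / cf_convergent ?d n) - 1 / (real_of_int (c 1) + 1 / ?Y 0)\<bar>"
    using ge2.prems(3)[of 0] ge2.prems(3)[of 1] by simp
  also have "\<dots> \<le> \<bar>cf_convergent ?d n - ?Y 0\<bar> / 4"
  proof (rule two_step_contraction)
    show "real_of_int (c 1) \<ge> 1" using ge2.prems(1)[of 1] by simp
    show "cf_convergent ?d n \<ge> 1" by (rule cf_convergent_ge_1) (simp add: ge2.prems(1))
    show "?Y 0 \<ge> 1" by (simp add: ge2.prems(2))
  qed
  also have "\<dots> \<le> 2 * (1 / 2) ^ n / 4"
    by (intro divide_right_mono ge2.IH(1)) (auto simp: ge2.prems(1,2) ge2.prems(3)[symmetric])
  finally show ?case by simp
qed

lemma convergents_tendsto: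
  fixes X :: "nat \<Rightarrow> real"
  assumes "\<And>i. i \<ge> 1 \<Longrightarrow> c i \<ge> 1" and "\<And>i. i \<ge> 1 \<Longrightarrow> X i \<ge> 1"
    and "\<And>i. X i = real_of_int (c i) + 1 / X (Suc i)"
  shows "cf_convergent c \<longlonglongrightarrow> X 0"
proof -
  have "(\<lambda>n. 2 * (1 / 2 :: real) ^ n) \<longlonglongrightarrow> 0"
    by (intro tendsto_mult_right_zero LIMSEQ_realpow_zero) auto
  then have "(\<lambda>n. cf_convergent c n - X 0) \<longlonglongrightarrow> 0"
    by (rule tendsto_0_le[where K = 1, OF _ always_eventually])
      (use convergents_error_bound[of c X, OF assms] in auto)
  then show ?thesis by (simp add: LIM_zero_iff)
qed

section \<open>Periodic continued fractions\<close>

text \<open>This is the finite continued fraction \<open>[b\<^sub>1; \<dots>, b\<^sub>l, t]\<close>. A real last entry \<open>t\<close> is allowed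
  so that appending blocks becomes composition of Moebius maps.\<close>

definition cf_append :: "int list \<Rightarrow> real \<Rightarrow> real" where
  "cf_append bs t = foldr (\<lambda>b u. real_of_int b + 1 / u) bs t"

lemma cf_append_simps [simp]:
  "cf_append [] t = t"
  "cf_append (b # bs) t = real_of_int b + 1 / cf_append bs t"
  "cf_append (bs @ cs) t = cf_append bs (cf_append cs t)"
  by (simp_all add: cf_append_def)

lemma cf_append_pos:
  assumes "\<forall>b\<in>set bs. b \<ge> 1" "t > 0"
  shows "cf_append bs t > 0"
  using assms by (induction bs) (auto intro!: add_pos_pos)

lemma cf_append_ge_1:
  assumes "\<forall>b\<in>set bs. b \<ge> 1" "t > 0" "bs \<noteq> []"
  shows "cf_append bs t \<ge> 1"
  using assms cf_append_pos[of "tl bs" t] by (cases bs) (auto intro!: add_increasing2)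

text \<open>The complete quotients are those of a single period: after \<open>j\<close> entries of the
  block the remaining value is the rest of the block followed by \<open>y\<close> itself.\<close>

lemma periodic_expansion:
  assumes pos: "\<forall>b\<in>set bs. b \<ge> 1" and ne: "bs \<noteq> []"
    and "y > 0" and fixpoint: "cf_append bs y = y"
  shows "has_cf_expansion (real_of_int a0 + 1 / y) (periodic_cf a0 bs)"
proof -
  let ?l = "length bs"
  let ?c = "periodic_cf a0 bs"
  define Y where "Y = (\<lambda>j. cf_append (drop (j mod ?l) bs) y)"
  define X where "X = case_nat (real_of_int a0 + 1 / y) Y"
  have mod_less: "j mod ?l < ?l" for j
    using ne by simp
  have c_ge_1: "?c i \<ge> 1" if "i \<ge> 1" for i
    using that pos mod_less by (cases i) (auto simp: periodic_cf_def)
  have "Y j \<ge> 1" for j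
    unfolding Y_def using pos \<open>y > 0\<close> mod_less[of j]
    by (intro cf_append_ge_1) (auto dest: in_set_dropD)
  then have X_ge_1: "X i \<ge> 1" if "i \<ge> 1" for i
    using that by (cases i) (auto simp: X_def)
  have Y_step: "Y j = real_of_int (bs ! (j mod ?l)) + 1 / Y (Suc j)" for j
  proof -
    have "Y (Suc j) = cf_append (drop (Suc (j mod ?l)) bs) y"
      using fixpoint mod_less[of j] by (auto simp: Y_def mod_Suc)
    then show ?thesis
      using Cons_nth_drop_Suc[OF mod_less[of j]] unfolding Y_def
      by (metis cf_append_simps(2))
  qed
  have "X i = real_of_int (?c i) + 1 / X (Suc i)" for i
  proof (cases i)
    case 0
    then show ?thesis using fixpoint by (simp add: X_def Y_def periodic_cf_def)
  next
    case (Suc j)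
    then show ?thesis using Y_step[of j] by (simp add: X_def periodic_cf_def)
  qed
  then have "cf_convergent ?c \<longlonglongrightarrow> X 0"
    using convergents_tendsto[of ?c X] c_ge_1 X_ge_1 by blast
  then show ?thesis
    using c_ge_1 by (fastforce simp: has_cf_expansion_def X_def)
qed

section \<open>Powers of the blocks (1, 1, 3) and (3, 1, 1)\<close>

lemma block_113:
  fixes u w :: real
  assumes "u > 0" "w > 0"
  shows "1 + 1 / (1 + 1 / (3 + 1 / (u / w))) = (7 * u + 2 * w) / (4 * u + w)"
proof -
  have pos: "3 * u + w > 0" "4 * u + w > 0" using assms by simp_all
  have inner: "1 + 1 / (3 + 1 / (u / w)) = (4 * u + w) / (3 * u + w)"
    using assms pos by (simp add: field_simps)
  show ?thesis unfolding inner using pos by (simp add: field_simps)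
qed

lemma block_311:
  fixes u w :: real
  assumes "u > 0" "w > 0"
  shows "3 + 1 / (1 + 1 / (1 + 1 / (u / w))) = (7 * u + 4 * w) / (2 * u + w)"
proof -
  have pos: "u + w > 0" "2 * u + w > 0" using assms by simp_all
  have inner: "1 + 1 / (1 + 1 / (u / w)) = (2 * u + w) / (u + w)"
    using assms pos by (simp add: field_simps)
  show ?thesis unfolding inner using pos by (simp add: field_simps)
qed

text \<open>The hypotheses on \<open>P\<close> and \<open>V\<close> are \<open>A\<^sup>k\<^sup>+\<^sup>1 = A A\<^sup>k\<close> for the first column
  \<open>(P k, 2 * V k)\<close> of \<open>A\<^sup>k\<close>. The positivity of the lower right entry \<open>P k - 3 * V k\<close> keeps the
  denominators below away from 0.\<close>

lemma block_matrix_pos: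
  fixes P V :: "nat \<Rightarrow> real"
  assumes "P 0 = 1" "V 0 = 0"
    and "\<And>j. P (Suc j) = 7 * P j + 4 * V j" "\<And>j. V (Suc j) = 2 * P j + V j"
  shows "P k \<ge> 1 \<and> V k \<ge> 0 \<and> P k - 3 * V k \<ge> 1"
  by (induction k) (auto simp: assms)

lemma cf_append_113_power:
  fixes P V :: "nat \<Rightarrow> real"
  assumes rec: "P 0 = 1" "V 0 = 0"
    "\<And>j. P (Suc j) = 7 * P j + 4 * V j" "\<And>j. V (Suc j) = 2 * P j + V j"
    and "t > 0"
  shows "cf_append (concat (replicate k [1, 1, 3])) t
    = (P k * t + V k) / (2 * V k * t + (P k - 3 * V k))"
proof (induction k)
  case 0
  then show ?case by (simp add: rec)
next
  case (Suc k)
  let ?u = "P k * t + V k" and ?w = "2 * V k * t + (P k - 3 * V k)"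
  have pos: "P k * t > 0" "V k * t \<ge> 0" "V k \<ge> 0" "P k - 3 * V k > 0"
    using block_matrix_pos[of P V k, OF rec] \<open>t > 0\<close> by auto
  then have "?u > 0" "?w > 0" by (simp_all add: add_pos_nonneg add_nonneg_pos)
  then have "1 + 1 / (1 + 1 / (3 + 1 / (?u / ?w))) = (7 * ?u + 2 * ?w) / (4 * ?u + ?w)"
    by (rule block_113)
  then have "cf_append (concat (replicate (Suc k) [1, 1, 3])) t = (7 * ?u + 2 * ?w) / (4 * ?u + ?w)"
    by (simp only: replicate_Suc concat.simps cf_append_simps Suc.IH of_int_1 of_int_numeral)
  moreover have "7 * ?u + 2 * ?w = P (Suc k) * t + V (Suc k)"
    by (simp add: rec algebra_simps)
  moreover have "4 * ?u + ?w = 2 * V (Suc k) * t + (P (Suc k) - 3 * V (Suc k))"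
    by (simp add: rec algebra_simps)
  ultimately show ?case by (simp only:)
qed

lemma cf_append_311_power:
  fixes P V :: "nat \<Rightarrow> real"
  assumes rec: "P 0 = 1" "V 0 = 0"
    "\<And>j. P (Suc j) = 7 * P j + 4 * V j" "\<And>j. V (Suc j) = 2 * P j + V j"
    and "t > 0"
  shows "cf_append (concat (replicate k [3, 1, 1])) t
    = (P k * t + 2 * V k) / (V k * t + (P k - 3 * V k))"
proof (induction k)
  case 0
  then show ?case by (simp add: rec)
next
  case (Suc k)
  let ?u = "P k * t + 2 * V k" and ?w = "V k * t + (P k - 3 * V k)"
  have pos: "P k * t > 0" "V k * t \<ge> 0" "V k \<ge> 0" "P k - 3 * V k > 0"
    using block_matrix_pos[of P V k, OF rec] \<open>t > 0\<close> by auto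
  then have "?u > 0" "?w > 0" by (simp_all add: add_pos_nonneg add_nonneg_pos)
  then have "3 + 1 / (1 + 1 / (1 + 1 / (?u / ?w))) = (7 * ?u + 4 * ?w) / (2 * ?u + ?w)"
    by (rule block_311)
  then have "cf_append (concat (replicate (Suc k) [3, 1, 1])) t = (7 * ?u + 4 * ?w) / (2 * ?u + ?w)"
    by (simp only: replicate_Suc concat.simps cf_append_simps Suc.IH of_int_1 of_int_numeral)
  moreover have "7 * ?u + 4 * ?w = P (Suc k) * t + 2 * V (Suc k)"
    by (simp add: rec algebra_simps)
  moreover have "2 * ?u + ?w = V (Suc k) * t + (P (Suc k) - 3 * V (Suc k))"
    by (simp add: rec algebra_simps)
  ultimately show ?case by (simp only:)
qed

text \<open>Two sequences with the recurrence of \<open>A\<^sup>k\<close> also satisfy the first-order system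
  of the matrix \<open>A\<close>, because the values \<open>(-1, 4)\<close> at -1 are the first column of \<open>A\<^sup>-\<^sup>1\<close>.\<close>

lemma pq_matrix_step:
  fixes p q :: "int \<Rightarrow> int"
  assumes "p (-1) = -1" "p 0 = 1" "\<And>j. j \<ge> 1 \<Longrightarrow> p j = 8 * p (j - 1) + p (j - 2)"
    and "q (-1) = 4" "q 0 = 0" "\<And>j. j \<ge> 1 \<Longrightarrow> q j = 8 * q (j - 1) + q (j - 2)"
  shows "p (int j) = 7 * p (int j - 1) + 2 * q (int j - 1)
    \<and> q (int j) = 4 * p (int j - 1) + q (int j - 1)"
proof (induction j)
  case 0
  then show ?case by (simp add: assms)
next
  case (Suc j)
  have "p (int (Suc j)) = 8 * p (int j) + p (int j - 1)"
    "q (int (Suc j)) = 8 * q (int j) + q (int j - 1)"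
    using assms(3,6)[of "int (Suc j)"] by simp_all
  then show ?case using Suc.IH by simp
qed

section \<open>The fixed point\<close>

text \<open>This is the fixed point equation with denominators cleared: \<open>u\<close> and \<open>w\<close> are numerator and
  denominator of \<open>[3, 1, 1, \<dots>, s]\<close>, so that \<open>a + w / u\<close> is that value preceded by \<open>a\<close>. In terms
  of \<open>N = 2 n + 1\<close>, both \<open>2 a\<close> and \<open>m\<close> are linear in \<open>N\<close>.\<close>

lemma fixed_point_identity:
  fixes s a m N p v :: real
  assumes s: "s\<^sup>2 = 2 * a * s + m" and a: "2 * a = p * N + 3" and m: "m = 2 * v * N + 2"
  defines "u \<equiv> p * s + 2 * v" and "w \<equiv> v * s + (p - 3 * v)"
  shows "m * (p * (a * u + w) + v * u) = s * (2 * v * (a * u + w) + (p - 3 * v) * u)"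
proof -
  \<comment> \<open>The entries of the symmetric matrix of the whole block.\<close>
  define P Q R where "P = a * p\<^sup>2 + 2 * p * v"
    and "Q = 2 * a * p * v + p * (p - 3 * v) + 2 * v\<^sup>2"
    and "R = 4 * a * v\<^sup>2 + 4 * v * (p - 3 * v)"
  have pN: "p * N = 2 * a - 3"
    using a by simp
  have "m * P = 2 * v * (p * N) * (a * p + 2 * v) + 2 * p * (a * p + 2 * v)"
    by (simp add: m P_def algebra_simps power2_eq_square)
  also have "\<dots> = 2 * a * Q + R"
    unfolding pN by (simp add: Q_def R_def algebra_simps power2_eq_square)
  finally have key: "m * P = 2 * a * Q + R" .
  have "m * (p * (a * u + w) + v * u) = (m * P) * s + m * Q"
    by (simp add: P_def Q_def u_def w_def algebra_simps power2_eq_square)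
  also have "\<dots> = Q * s\<^sup>2 + R * s"
    unfolding key s by (simp add: algebra_simps)
  also have "\<dots> = s * (2 * v * (a * u + w) + (p - 3 * v) * u)"
    by (simp add: Q_def R_def u_def w_def algebra_simps power2_eq_square)
  finally show ?thesis .
qed

theorem theorem3:
  fixes p q :: "int \<Rightarrow> int" and k n :: nat and a :: int
  assumes p_minus_1: "p (-1) = -1" and p_0: "p 0 = 1"
    and p_rec: "\<And>j. j \<ge> 1 \<Longrightarrow> p j = 8 * p (j - 1) + p (j - 2)"
    and q_minus_1: "q (-1) = 4" and q_0: "q 0 = 0"
    and q_rec: "\<And>j. j \<ge> 1 \<Longrightarrow> q j = 8 * q (j - 1) + q (j - 2)"
    and k: "k \<ge> 1"
    and a: "a = p (int k) * int n + (p (int k) + 3) div 2"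
  shows "has_cf_expansion
    (sqrt (real_of_int (a\<^sup>2 + (2 * q (int k) * int n + q (int k) + 2))))
    (periodic_cf a (concat (replicate k [1, 1, 3]) @ [a] @ concat (replicate k [3, 1, 1]) @ [2 * a]))"
proof -
  define P V :: "nat \<Rightarrow> real" where "P = (\<lambda>j. real_of_int (p (int j)))"
    and "V = (\<lambda>j. real_of_int (q (int j)) / 2)"
  have "p (int (Suc j)) = 7 * p (int j) + 2 * q (int j)"
    "q (int (Suc j)) = 4 * p (int j) + q (int j)" for j
    using pq_matrix_step[OF p_minus_1 p_0 p_rec q_minus_1 q_0 q_rec, of "Suc j"] by simp_all
  then have rec: "P 0 = 1" "V 0 = 0"
    "\<And>j. P (Suc j) = 7 * P j + 4 * V j" "\<And>j. V (Suc j) = 2 * P j + V j"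
    unfolding P_def V_def by (simp_all add: p_0 q_0 field_simps del: of_nat_Suc)
  have PV: "P k \<ge> 1" "V k \<ge> 0" "P k - 3 * V k \<ge> 1"
    using block_matrix_pos[of P V k, OF rec] by auto

  define N where "N = 2 * real n + 1"
  define m where "m = 2 * V k * N + 2"
  define x where "x = sqrt ((real_of_int a)\<^sup>2 + m)"
  define s where "s = x + real_of_int a"
  define y where "y = s / m"

  have "2 * a = p (int k) * (2 * int n + 1) + 3"
    using even_seq_plus_3[OF p_minus_1 p_0 p_rec, of k] by (simp add: a algebra_simps)
  then have "real_of_int (2 * a) = real_of_int (p (int k) * (2 * int n + 1) + 3)"
    by (rule arg_cong)
  then have two_a: "2 * real_of_int a = P k * N + 3"
    by (simp add: P_def N_def)
  moreover have "P k * N \<ge> 0"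
    using PV by (simp add: N_def)
  ultimately have "a \<ge> 1" by linarith
  have "m > 0"
    using PV by (simp add: m_def N_def add_nonneg_pos)
  then have x_sq: "x\<^sup>2 = (real_of_int a)\<^sup>2 + m"
    by (simp add: x_def)
  have "x \<ge> 0"
    using \<open>m > 0\<close> by (simp add: x_def)
  then have "s > 0"
    using \<open>a \<ge> 1\<close> by (simp add: s_def)
  then have "y > 0"
    using \<open>m > 0\<close> by (simp add: y_def)
  have s_sq: "s\<^sup>2 = 2 * real_of_int a * s + m"
    using x_sq by (simp add: s_def power2_eq_square algebra_simps)
  have inv_y: "1 / y = s - 2 * real_of_int a"
    using s_sq \<open>s > 0\<close> \<open>m > 0\<close> by (simp add: y_def field_simps power2_eq_square)

  define u where "u = P k * s + 2 * V k"
  define w where "w = V k * s + (P k - 3 * V k)"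
  have "u > 0" "w > 0"
    using PV \<open>s > 0\<close> add_pos_nonneg[of "P k * s" "2 * V k"] add_nonneg_pos[of "V k * s" "P k - 3 * V k"]
    by (simp_all add: u_def w_def)
  define t where "t = real_of_int a + w / u"
  have "t > 0"
    using \<open>u > 0\<close> \<open>w > 0\<close> \<open>a \<ge> 1\<close> by (simp add: t_def add_pos_pos)
  let ?bs = "concat (replicate k [1, 1, 3]) @ [a] @ concat (replicate k [3, 1, 1]) @ [2 * a]"
  have "cf_append ?bs y = cf_append (concat (replicate k [1, 1, 3]))
      (real_of_int a + 1 / cf_append (concat (replicate k [3, 1, 1])) s)"
    using inv_y by simp
  also have "\<dots> = (P k * t + V k) / (2 * V k * t + (P k - 3 * V k))"
    using cf_append_113_power[of P V t k, OF rec \<open>t > 0\<close>]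
      cf_append_311_power[of P V s k, OF rec \<open>s > 0\<close>]
    by (simp add: t_def u_def w_def)
  also have "\<dots> = y"
  proof -
    have "m * (P k * (t * u) + V k * u) = s * (2 * V k * (t * u) + (P k - 3 * V k) * u)"
      using fixed_point_identity[OF s_sq two_a m_def] \<open>u > 0\<close>
      by (simp add: t_def distrib_right flip: u_def w_def)
    then have "u * (m * (P k * t + V k)) = u * (s * (2 * V k * t + (P k - 3 * V k)))"
      by (simp add: algebra_simps)
    then have "m * (P k * t + V k) = s * (2 * V k * t + (P k - 3 * V k))"
      using \<open>u > 0\<close> by simp
    moreover have "2 * V k * t + (P k - 3 * V k) > 0"
      using PV \<open>t > 0\<close> by (intro add_nonneg_pos) auto
    ultimately show ?thesis
      using \<open>m > 0\<close> by (simp add: y_def frac_eq_eq mult.commute)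
  qed
  finally have "cf_append ?bs y = y" .
  moreover have "\<forall>b\<in>set ?bs. b \<ge> 1"
    using \<open>a \<ge> 1\<close> by auto
  ultimately have "has_cf_expansion (real_of_int a + 1 / y) (periodic_cf a ?bs)"
    using \<open>y > 0\<close> by (intro periodic_expansion) auto
  moreover have "real_of_int a + 1 / y = x"
    by (simp add: inv_y s_def)
  moreover have "x = sqrt (real_of_int (a\<^sup>2 + (2 * q (int k) * int n + q (int k) + 2)))"
    by (simp add: x_def m_def V_def N_def algebra_simps)
  ultimately show ?thesis by simp
qed

end
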